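(* Let $nx,ny,nz\ge 1$ be integers and let $V$ be the space of grid functions $\mathbf{v}=(\mathbf{v}_{j,k,l})$, $1\le j\le nx$, $1\le k\le ny$, $1\le l\le nz$, with values $\mathbf{v}_{j,k,l}\in\mathbb{R}^3$ (so $\dim V=3\,nx\,ny\,nz$). Let $\epsilon>0$, $\alpha\ge 0$, $\eta\ge 0$ be constants, let $h>0$ be the grid size and $\Delta t>0$ the time step, and let $\Delta_h:V\to V$ be the discrete Neumann Laplacian defined in the context. Let $\mathbf{m}^{n-1},\mathbf{m}^n\in V$ be given. Denote by $I$ the identity operator on $V$, by $S=\epsilon\Delta t\,\Delta_h-\alpha\left(1+\frac{2\eta}{\Delta t}\right)I$, and by $A:V\to V$ the antisymmetric operator $(A\mathbf{v})_{j,k,l}=\mathbf{m}^n_{j,k,l}\times\mathbf{v}_{j,k,l}$ (pointwise cross product). Then $\det(I+AS)\neq 0$. That is, for any $h>0$ and $\Delta t>0$, the linear system $$\left(I+\epsilon\Delta t\,\mathbf{m}^n\times\Delta_h-\alpha\left(1+\frac{2\eta}{\Delta t}\right)\mathbf{m}^n\times\right)\tilde{\mathbf{m}}^{n+1}=\mathbf{m}^{n-1}-\epsilon\Delta t\,\mathbf{m}^n\times\Delta_h\mathbf{m}^{n-1}-\alpha\left(1-\frac{2\eta}{\Delta t}\right)\mathbf{m}^n\times\mathbf{m}^{n-1}-2\Delta t\,\mathbf{m}^n\times\mathbf{f}(\mathbf{m}^n)$$ admits a unique solution $\tilde{\mathbf{m}}^{n+1}\in V$.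
   Context: All cross products are taken pointwise at each grid point, and $\mathbf{m}^n\times\Delta_h$ denotes the operator $\mathbf{v}\mapsto\mathbf{m}^n\times(\Delta_h\mathbf{v})$. With $\Delta x=\Delta y=\Delta z=h$, the discrete Laplacian $\Delta_h$ with homogeneous Neumann boundary condition is $$(\Delta_h\mathbf{v})_{j,k,l}=\frac{\mathbf{v}_{j+1,k,l}-2\mathbf{v}_{j,k,l}+\mathbf{v}_{j-1,k,l}}{\Delta x^2}+\frac{\mathbf{v}_{j,k+1,l}-2\mathbf{v}_{j,k,l}+\mathbf{v}_{j,k-1,l}}{\Delta y^2}+\frac{\mathbf{v}_{j,k,l+1}-2\mathbf{v}_{j,k,l}+\mathbf{v}_{j,k,l-1}}{\Delta z^2}$$ for $1\le j\le nx$, $1\le k\le ny$, $1\le l\le nz$, where the ghost values are $\mathbf{v}_{0,k,l}=\mathbf{v}_{1,k,l}$, $\mathbf{v}_{nx+1,k,l}=\mathbf{v}_{nx,k,l}$, $\mathbf{v}_{j,0,l}=\mathbf{v}_{j,1,l}$, $\mathbf{v}_{j,ny+1,l}=\mathbf{v}_{j,ny,l}$, $\mathbf{v}_{j,k,0}=\mathbf{v}_{j,k,1}$, $\mathbf{v}_{j,k,nz+1}=\mathbf{v}_{j,k,nz}$. The term $\mathbf{f}(\mathbf{m}^n)\in V$ is the explicit part of the effective field, $\mathbf{f}(\mathbf{m}^n)=-q(m_2^n\mathbf{e}_2+m_3^n\mathbf{e}_3)+\mathbf{h}_e+\mathbf{h}_s^n$, where $q\in\mathbb{R}$ is a constant,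 $\mathbf{e}_2=(0,1,0)^T$, $\mathbf{e}_3=(0,0,1)^T$, $m_i^n$ are the components of $\mathbf{m}^n$, $\mathbf{h}_e\in V$ is a given applied field, and $\mathbf{h}_s^n\in V$ is the (numerically evaluated) stray field determined by $\mathbf{m}^n$; for the present purpose $\mathbf{f}(\mathbf{m}^n)$ is a known element of $V$ once $\mathbf{m}^n$ is given. *)

theory Defs
  imports
    "Jordan_Normal_Form.Determinant"
    "HOL-Analysis.Analysis"
    "HOL-Library.Function_Algebras"
begin

no_notation Matrix.vec_index (infixl "$" 100)

type_synonym gridfun = "nat \<Rightarrow> nat \<Rightarrow> nat \<Rightarrow> real^3"

(* Grid functions are total functions that vanish off the grid, so that equality of
   elements of V is equality at all grid points.  Addition, subtraction and negation
   of grid functions are the pointwise ones of Function_Algebras. *)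
definition V :: "nat \<Rightarrow> nat \<Rightarrow> nat \<Rightarrow> gridfun set" where
  "V nx ny nz = {v. \<forall>j k l. (j, k, l) \<notin> {1..nx} \<times> {1..ny} \<times> {1..nz} \<longrightarrow> v j k l = 0}"

definition gscale :: "real \<Rightarrow> gridfun \<Rightarrow> gridfun" (infixr "*\<^sub>g" 75) where
  "c *\<^sub>g v = (\<lambda>j k l. c *\<^sub>R v j k l)"

definition gcross :: "gridfun \<Rightarrow> gridfun \<Rightarrow> gridfun" (infixr "\<times>\<^sub>g" 80) where
  "u \<times>\<^sub>g v = (\<lambda>j k l. cross3 (u j k l) (v j k l))"

(* Homogeneous Neumann condition: the value at the ghost index 0 is the one at 1,
   the value at the ghost index n + 1 is the one at n. *)
definition ghost :: "nat \<Rightarrow> nat \<Rightarrow> nat" where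
  "ghost n i = (if i = 0 then 1 else if i = n + 1 then n else i)"

definition neumann_ext :: "nat \<Rightarrow> nat \<Rightarrow> nat \<Rightarrow> gridfun \<Rightarrow> gridfun" where
  "neumann_ext nx ny nz v = (\<lambda>j k l. v (ghost nx j) (ghost ny k) (ghost nz l))"

definition laplacian :: "nat \<Rightarrow> nat \<Rightarrow> nat \<Rightarrow> real \<Rightarrow> gridfun \<Rightarrow> gridfun" where
  "laplacian nx ny nz h v = (let w = neumann_ext nx ny nz v in
     (\<lambda>j k l. if (j, k, l) \<in> {1..nx} \<times> {1..ny} \<times> {1..nz} then
         (w (j+1) k l - 2 *\<^sub>R w j k l + w (j-1) k l) /\<^sub>R h\<^sup>2
       + (w j (k+1) l - 2 *\<^sub>R w j k l + w j (k-1) l) /\<^sub>R h\<^sup>2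
       + (w j k (l+1) - 2 *\<^sub>R w j k l + w j k (l-1)) /\<^sub>R h\<^sup>2
      else 0))"

definition opS :: "nat \<Rightarrow> nat \<Rightarrow> nat \<Rightarrow> real \<Rightarrow> real \<Rightarrow> real \<Rightarrow> real \<Rightarrow> real \<Rightarrow> gridfun \<Rightarrow> gridfun" where
  "opS nx ny nz h dt \<epsilon> \<alpha> \<eta> v =
     (\<epsilon> * dt) *\<^sub>g laplacian nx ny nz h v - (\<alpha> * (1 + 2 * \<eta> / dt)) *\<^sub>g v"

definition opA :: "gridfun \<Rightarrow> gridfun \<Rightarrow> gridfun" where
  "opA m v = m \<times>\<^sub>g v"

(* The stray field is an arbitrary map hs of the magnetization. *)
definition explicit_field :: "real \<Rightarrow> gridfun \<Rightarrow> (gridfun \<Rightarrow> gridfun) \<Rightarrow> gridfun \<Rightarrow> gridfun" where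
  "explicit_field q he hs m =
     - (q *\<^sub>g (\<lambda>j k l. (m j k l $ 2) *\<^sub>R axis 2 1 + (m j k l $ 3) *\<^sub>R axis 3 1)) + he + hs m"

(* Determinant of an operator T on V: the determinant of its matrix in the basis of unit
   grid functions, enumerated by r < 3 * nx * ny * nz; coord gives the grid point and
   the component of the r-th basis vector.  Components live in the three-element type 3,
   where the value 0 is the component 3. *)
definition coord :: "nat \<Rightarrow> nat \<Rightarrow> nat \<Rightarrow> (nat \<times> nat \<times> nat) \<times> 3" where
  "coord nx ny r =
     ((r div 3 mod nx + 1, r div (3 * nx) mod ny + 1, r div (3 * nx * ny) + 1),
      of_nat (r mod 3 + 1))"

definition grid_at :: "gridfun \<Rightarrow> (nat \<times> nat \<times> nat) \<times> 3 \<Rightarrow> real" where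
  "grid_at v = (\<lambda>((j, k, l), i). v j k l $ i)"

definition unit_gridfun :: "(nat \<times> nat \<times> nat) \<times> 3 \<Rightarrow> gridfun" where
  "unit_gridfun = (\<lambda>(p, i) j k l. if (j, k, l) = p then axis i 1 else 0)"

definition op_matrix :: "nat \<Rightarrow> nat \<Rightarrow> nat \<Rightarrow> (gridfun \<Rightarrow> gridfun) \<Rightarrow> real Matrix.mat" where
  "op_matrix nx ny nz T = Matrix.mat (3 * nx * ny * nz) (3 * nx * ny * nz)
     (\<lambda>(r, c). grid_at (T (unit_gridfun (coord nx ny c))) (coord nx ny r))"

definition op_det :: "nat \<Rightarrow> nat \<Rightarrow> nat \<Rightarrow> (gridfun \<Rightarrow> gridfun) \<Rightarrow> real" where
  "op_det nx ny nz T = Determinant.det (op_matrix nx ny nz T)"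

lemma bij_betw_coord:
  assumes "nx \<ge> 1" "ny \<ge> 1"
  shows "bij_betw (coord nx ny) {..<3 * nx * ny * nz} (({1..nx} \<times> {1..ny} \<times> {1..nz}) \<times> UNIV)"
proof -
  let ?N = "3 * nx * ny * nz"
  have comp: "r = s" if "r < 3" "s < 3" "(of_nat (r + 1) :: 3) = of_nat (s + 1)" for r s :: nat
  proof -
    have "r \<in> {0, 1, 2}" "s \<in> {0, 1, 2}" using that(1,2) by auto
    then show ?thesis using that(3) by auto
  qed
  have dec: "r = r mod 3 + 3 * (r div 3 mod nx + nx * (r div (3 * nx) mod ny + ny * (r div (3 * nx * ny))))"
    for r :: nat
    by (simp add: div_mult2_eq)
  have inj: "inj_on (coord nx ny) {..<?N}"
  proof (rule inj_onI)
    fix r s assume "coord nx ny r = coord nx ny s"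
    then have e: "r div 3 mod nx = s div 3 mod nx" "r div (3 * nx) mod ny = s div (3 * nx) mod ny"
      "r div (3 * nx * ny) = s div (3 * nx * ny)" and "(of_nat (r mod 3 + 1) :: 3) = of_nat (s mod 3 + 1)"
      unfolding coord_def prod.inject by simp_all
    from this(4) have "r mod 3 = s mod 3" by (intro comp) simp_all
    with e show "r = s" using dec[of r] dec[of s] by simp
  qed
  have sub: "coord nx ny ` {..<?N} \<subseteq> ({1..nx} \<times> {1..ny} \<times> {1..nz}) \<times> UNIV"
  proof -
    have "r div (3 * nx * ny) < nz" if "r < ?N" for r
      using that by (simp add: less_mult_imp_div_less mult.commute)
    moreover have "r div 3 mod nx < nx" "r div (3 * nx) mod ny < ny" for r
      using assms by simp_all
    ultimately show ?thesis by (auto simp: coord_def Suc_le_eq)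
  qed
  have "card (coord nx ny ` {..<?N}) = card (({1..nx} \<times> {1..ny} \<times> {1..nz}) \<times> (UNIV :: 3 set))"
    using inj by (simp add: card_image card_cartesian_product)
  then have "coord nx ny ` {..<?N} = ({1..nx} \<times> {1..ny} \<times> {1..nz}) \<times> UNIV"
    using sub by (intro card_subset_eq) auto
  with inj show ?thesis by (simp add: bij_betw_def)
qed

end

theory Submission
  imports Defs
begin

text \<open>If \<open>v + A S v = 0\<close>, then pairing with \<open>S v\<close> gives \<open>v \<bullet> S v = 0\<close> at every
  grid point, because \<open>m \<times> w\<close> is orthogonal to \<open>w\<close>.  Summation by parts writes the sum of
  \<open>v \<bullet> S v\<close> as minus a positive multiple of the sum of all squared differences minus a nonnegative
  multiple of the sum of \<open>v \<bullet> v\<close>.  Hence all differences vanish, so \<open>S v\<close> is a multiple of \<open>v\<close>,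
  and \<open>v = - m \<times> S v\<close> is orthogonal to itself.  An injective operator on the finite-dimensional
  space \<open>V\<close> has nonzero determinant and is bijective.\<close>

no_notation Matrix.scalar_prod (infix "\<bullet>" 70)

section \<open>Operators on grid functions and their matrices\<close>

lemma sum_fun_apply: "(\<Sum>a\<in>A. f a) x = (\<Sum>a\<in>A. f a x)"
  by (induction A rule: infinite_finite_induct) (auto simp: plus_fun_def)

lemma grid_at_sum: "grid_at (\<Sum>a\<in>A. f a) p = (\<Sum>a\<in>A. grid_at (f a) p)"
  by (cases p) (auto simp: grid_at_def sum_fun_apply)

lemma grid_at_gscale: "grid_at (c *\<^sub>g v) p = c * grid_at v p"
  by (cases p) (auto simp: grid_at_def gscale_def)

lemma grid_at_unit_gridfun: "grid_at (unit_gridfun p) p' = of_bool (p = p')"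
  by (cases p; cases p') (auto simp: grid_at_def unit_gridfun_def axis_def)

lemma grid_at_zero: "grid_at 0 p = 0"
  by (cases p) (auto simp: grid_at_def)

lemma V_zero: "0 \<in> V nx ny nz"
  and V_add: "u \<in> V nx ny nz \<Longrightarrow> v \<in> V nx ny nz \<Longrightarrow> u + v \<in> V nx ny nz"
  and V_diff: "u \<in> V nx ny nz \<Longrightarrow> v \<in> V nx ny nz \<Longrightarrow> u - v \<in> V nx ny nz"
  and V_gscale: "v \<in> V nx ny nz \<Longrightarrow> c *\<^sub>g v \<in> V nx ny nz"
  and V_gcross: "u \<in> V nx ny nz \<Longrightarrow> u \<times>\<^sub>g v \<in> V nx ny nz"
  by (auto simp: V_def gscale_def gcross_def)

text \<open>Equality in \<open>V\<close> becomes a statement about finitely many coordinates: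
  \<open>coord\<close> reaches every pair of a grid point and a component, and off the grid both
  functions vanish.\<close>

lemma V_eqI:
  assumes "nx \<ge> 1" "ny \<ge> 1" "u \<in> V nx ny nz" "v \<in> V nx ny nz"
    and eq: "\<And>r. r < 3 * nx * ny * nz \<Longrightarrow> grid_at u (coord nx ny r) = grid_at v (coord nx ny r)"
  shows "u = v"
proof (intro ext)
  fix j k l
  show "u j k l = v j k l"
  proof (cases "(j, k, l) \<in> {1..nx} \<times> {1..ny} \<times> {1..nz}")
    case True
    have "u j k l $ i = v j k l $ i" for i
    proof -
      have "((j, k, l), i) \<in> coord nx ny ` {..<3 * nx * ny * nz}"
        using True bij_betw_coord[OF assms(1,2)] by (auto simp: bij_betw_def)
      then obtain r where "r < 3 * nx * ny * nz" "coord nx ny r = ((j, k, l), i)"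
        by auto
      with eq[of r] show ?thesis by (simp add: grid_at_def)
    qed
    then show ?thesis by (simp add: vec_eq_iff)
  next
    case False
    with assms(3,4) show ?thesis by (simp add: V_def)
  qed
qed

text \<open>The inverse of taking coordinates: it turns a coordinate vector into the element of
  \<open>V\<close> that it describes.\<close>

definition lincomb_units :: "nat \<Rightarrow> nat \<Rightarrow> nat \<Rightarrow> (nat \<Rightarrow> real) \<Rightarrow> gridfun" where
  "lincomb_units nx ny nz x = (\<Sum>c<3 * nx * ny * nz. x c *\<^sub>g unit_gridfun (coord nx ny c))"

lemma grid_at_lincomb_units:
  assumes "nx \<ge> 1" "ny \<ge> 1" "r < 3 * nx * ny * nz"
  shows "grid_at (lincomb_units nx ny nz x) (coord nx ny r) = x r"
proof -
  have "inj_on (coord nx ny) {..<3 * nx * ny * nz}"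
    using bij_betw_coord[OF assms(1,2)] by (auto simp: bij_betw_def)
  then have "grid_at (lincomb_units nx ny nz x) (coord nx ny r)
      = (\<Sum>c<3 * nx * ny * nz. if c = r then x c else 0)"
    using assms(3) unfolding lincomb_units_def grid_at_sum grid_at_gscale grid_at_unit_gridfun
    by (intro sum.cong) (auto dest: inj_onD)
  with assms(3) show ?thesis by simp
qed

lemma unit_gridfun_coord_in_V:
  assumes "nx \<ge> 1" "ny \<ge> 1" "c < 3 * nx * ny * nz"
  shows "unit_gridfun (coord nx ny c) \<in> V nx ny nz"
proof -
  have "coord nx ny c \<in> ({1..nx} \<times> {1..ny} \<times> {1..nz}) \<times> UNIV"
    using bij_betwE[OF bij_betw_coord[OF assms(1,2), of nz]] assms(3) by blast
  then show ?thesis by (auto simp: unit_gridfun_def V_def)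
qed

lemma V_sum: "(\<And>a. a \<in> A \<Longrightarrow> f a \<in> V nx ny nz) \<Longrightarrow> (\<Sum>a\<in>A. f a) \<in> V nx ny nz"
  by (induction A rule: infinite_finite_induct) (auto intro: V_zero V_add)

lemma lincomb_units_in_V:
  assumes "nx \<ge> 1" "ny \<ge> 1"
  shows "lincomb_units nx ny nz x \<in> V nx ny nz"
  unfolding lincomb_units_def
  using unit_gridfun_coord_in_V[OF assms] by (intro V_sum V_gscale) auto

text \<open>Linearity is asked on all functions rather than only on \<open>V\<close>, so that
  rewriting sums creates no membership conditions.\<close>

definition grid_linear :: "(gridfun \<Rightarrow> gridfun) \<Rightarrow> bool" where
  "grid_linear T \<longleftrightarrow> (\<forall>u v. T (u + v) = T u + T v) \<and> (\<forall>c v. T (c *\<^sub>g v) = c *\<^sub>g T v)"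

lemma grid_linear_diff:
  assumes "grid_linear T"
  shows "T (u - v) = T u - T v"
proof -
  have "T (u - v + v) = T (u - v) + T v"
    using assms unfolding grid_linear_def by blast
  then show ?thesis
    unfolding diff_add_cancel by (metis add_diff_cancel_right')
qed

lemma grid_linear_sum:
  assumes "grid_linear T"
  shows "T (\<Sum>a\<in>A. x a *\<^sub>g f a) = (\<Sum>a\<in>A. x a *\<^sub>g T (f a))"
proof -
  have "T 0 = 0"
    using grid_linear_diff[OF assms, of 0 0] by simp
  with assms show ?thesis
    by (induction A rule: infinite_finite_induct) (auto simp: grid_linear_def)
qed

text \<open>The columns of the matrix are the coordinates of the images of the unit grid functions,
  so by linearity the matrix acts on coordinates as \<open>T\<close> acts on
  \<open>V\<close>.\<close>

lemma op_matrix_mult_vec: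
  assumes "grid_linear T" "x \<in> carrier_vec (3 * nx * ny * nz)" "r < 3 * nx * ny * nz"
  shows "vec_index (op_matrix nx ny nz T *\<^sub>v x) r
    = grid_at (T (lincomb_units nx ny nz (vec_index x))) (coord nx ny r)"
proof -
  have "vec_index (op_matrix nx ny nz T *\<^sub>v x) r
    = (\<Sum>c<3 * nx * ny * nz. grid_at (T (unit_gridfun (coord nx ny c))) (coord nx ny r) * vec_index x c)"
    using assms(2,3) by (simp add: op_matrix_def scalar_prod_def lessThan_atLeast0)
  also have "\<dots> = grid_at (T (lincomb_units nx ny nz (vec_index x))) (coord nx ny r)"
    unfolding lincomb_units_def grid_linear_sum[OF assms(1)] grid_at_sum grid_at_gscale
    by (intro sum.cong refl mult.commute)
  finally show ?thesis .
qed

text \<open>A kernel vector of the matrix would yield a nonzero kernel element of \<open>T\<close>.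
  The determinant is therefore nonzero, and the inverse matrix produces a preimage of every
  \<open>b\<close>; injectivity makes it unique.\<close>

proposition injective_operator_on_V:
  assumes nx: "nx \<ge> 1" "ny \<ge> 1" and lin: "grid_linear T"
    and V: "\<And>v. v \<in> V nx ny nz \<Longrightarrow> T v \<in> V nx ny nz"
    and inj: "\<And>v. v \<in> V nx ny nz \<Longrightarrow> T v = 0 \<Longrightarrow> v = 0"
  shows "op_det nx ny nz T \<noteq> 0"
    and "b \<in> V nx ny nz \<Longrightarrow> \<exists>!u. u \<in> V nx ny nz \<and> T u = b"
proof -
  define N where "N = 3 * nx * ny * nz"
  let ?M = "op_matrix nx ny nz T" and ?L = "\<lambda>x. lincomb_units nx ny nz (vec_index x)"
  have M: "?M \<in> carrier_mat N N" by (simp add: op_matrix_def N_def)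
  show det: "op_det nx ny nz T \<noteq> 0"
  proof
    assume "op_det nx ny nz T = 0"
    then obtain x where x: "x \<in> carrier_vec N" "x \<noteq> 0\<^sub>v N" "?M *\<^sub>v x = 0\<^sub>v N"
      using det_0_iff_vec_prod_zero[OF M] by (auto simp: op_det_def)
    have "T (?L x) = 0"
    proof (rule V_eqI[OF nx])
      show "T (?L x) \<in> V nx ny nz" by (intro V lincomb_units_in_V nx)
      show "0 \<in> V nx ny nz" by (rule V_zero)
      fix r assume r: "r < 3 * nx * ny * nz"
      show "grid_at (T (?L x)) (coord nx ny r) = grid_at 0 (coord nx ny r)"
        using op_matrix_mult_vec[OF lin _ r, of x] x r by (simp add: N_def grid_at_zero)
    qed
    then have L0: "?L x = 0" by (rule inj[OF lincomb_units_in_V[OF nx]])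
    \<comment> \<open>The coordinates of \<open>?L x\<close> are the entries of \<open>x\<close>, so
      \<open>?L x = 0\<close> contradicts the choice of a nonzero \<open>x\<close>.\<close>
    have "vec_index x r = 0" if "r < N" for r
      using grid_at_lincomb_units[OF nx that[unfolded N_def], of "vec_index x"]
      unfolding L0 grid_at_zero by simp
    with x(1) have "x = 0\<^sub>v N" by (intro eq_vecI) auto
    with x(2) show False by simp
  qed
  assume b: "b \<in> V nx ny nz"
  \<comment> \<open>A nonzero determinant makes the matrix a unit of the matrix ring;
    \<open>()\<close> only fills the extension slot of the ring record.\<close>
  obtain B where B: "B \<in> carrier_mat N N" "?M * B = 1\<^sub>m N"
    using det_non_zero_imp_unit[OF M det[unfolded op_det_def], of "()"]
    unfolding Units_def ring_mat_def by auto
  define y where "y = Matrix.vec N (\<lambda>r. grid_at b (coord nx ny r))"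
  have y: "y \<in> carrier_vec N" by (simp add: y_def)
  have x: "B *\<^sub>v y \<in> carrier_vec N" using B y by auto
  have My: "?M *\<^sub>v (B *\<^sub>v y) = y"
    unfolding assoc_mult_mat_vec[OF M B(1) y, symmetric] B(2) by (rule one_mult_mat_vec[OF y])
  have ex: "T (?L (B *\<^sub>v y)) = b"
  proof (rule V_eqI[OF nx _ b])
    show "T (?L (B *\<^sub>v y)) \<in> V nx ny nz" by (intro V lincomb_units_in_V nx)
    fix r assume r: "r < 3 * nx * ny * nz"
    show "grid_at (T (?L (B *\<^sub>v y))) (coord nx ny r) = grid_at b (coord nx ny r)"
      using op_matrix_mult_vec[OF lin x[unfolded N_def] r] r unfolding My by (simp add: N_def y_def)
  qed
  show "\<exists>!u. u \<in> V nx ny nz \<and> T u = b"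
  proof (rule ex1I)
    show "?L (B *\<^sub>v y) \<in> V nx ny nz \<and> T (?L (B *\<^sub>v y)) = b"
      by (intro conjI ex lincomb_units_in_V nx)
    fix u assume u: "u \<in> V nx ny nz \<and> T u = b"
    then have "T (u - ?L (B *\<^sub>v y)) = 0"
      unfolding grid_linear_diff[OF lin] ex by simp
    then have "u - ?L (B *\<^sub>v y) = 0"
      by (rule inj[OF V_diff[OF conjunct1[OF u] lincomb_units_in_V[OF nx]]])
    then show "u = ?L (B *\<^sub>v y)" by simp
  qed
qed

section \<open>Summation by parts\<close>

text \<open>With \<open>d = g (n + 1) - g n\<close>, the induction step rests on
  \<open>g n \<bullet> d + d \<bullet> d = g (n + 1) \<bullet> d\<close>. The squares start at
  \<open>i = 0\<close>, so the difference across the lower ghost value is included.\<close>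

lemma sum_by_parts_second_difference:
  fixes g :: "nat \<Rightarrow> 'a::real_inner"
  shows "(\<Sum>i=1..n. g i \<bullet> (g (i + 1) - 2 *\<^sub>R g i + g (i - 1)))
    = g n \<bullet> (g (n + 1) - g n) - g 0 \<bullet> (g 1 - g 0) - (\<Sum>i<n. (norm (g (i + 1) - g i))\<^sup>2)"
proof (induction n)
  case (Suc n)
  then show ?case
    by (simp add: power2_norm_eq_inner scaleR_2 inner_diff_left inner_diff_right inner_add_right inner_commute)
qed simp

text \<open>The ghost values kill both boundary terms, leaving minus a sum of squares. If that sum
  is zero, \<open>g\<close> is constant, ghost values included.\<close>

lemma neumann_second_difference:
  fixes g :: "nat \<Rightarrow> 'a::real_inner"
  assumes "g 0 = g 1" "g (n + 1) = g n"
  shows "(\<Sum>i=1..n. g i \<bullet> (g (i + 1) - 2 *\<^sub>R g i + g (i - 1))) \<le> 0"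
    and "(\<Sum>i=1..n. g i \<bullet> (g (i + 1) - 2 *\<^sub>R g i + g (i - 1))) = 0
      \<Longrightarrow> i \<in> {1..n} \<Longrightarrow> g (i + 1) - 2 *\<^sub>R g i + g (i - 1) = 0"
proof -
  have eq: "(\<Sum>i=1..n. g i \<bullet> (g (i + 1) - 2 *\<^sub>R g i + g (i - 1)))
      = - (\<Sum>i<n. (norm (g (i + 1) - g i))\<^sup>2)"
    using assms unfolding sum_by_parts_second_difference by simp
  then show "(\<Sum>i=1..n. g i \<bullet> (g (i + 1) - 2 *\<^sub>R g i + g (i - 1))) \<le> 0"
    by (simp add: sum_nonneg)
  assume "(\<Sum>i=1..n. g i \<bullet> (g (i + 1) - 2 *\<^sub>R g i + g (i - 1))) = 0" and i: "i \<in> {1..n}"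
  then have flat: "g (j + 1) = g j" if "j < n" for j
    using eq that by (simp add: sum_nonneg_eq_0_iff)
  \<comment> \<open>At \<open>i = n\<close> the sum of squares gives no information on the forward
    difference; the upper ghost value does.\<close>
  have "g (i + 1) = g i"
    using flat[of i] assms(2) i by (cases "i = n") auto
  moreover have "g (i - 1) = g i"
    using flat[of "i - 1"] i by force
  ultimately show "g (i + 1) - 2 *\<^sub>R g i + g (i - 1) = 0"
    by (simp add: scaleR_2)
qed

text \<open>Meant for all grid lines in one coordinate direction: \<open>p\<close> and
  \<open>q\<close> are the two frozen indices. As every line contributes a nonpositive amount, a
  zero total forces each contribution to be zero.\<close>

lemma neumann_second_difference_family:
  fixes g :: "'b \<Rightarrow> 'c \<Rightarrow> nat \<Rightarrow> 'a::real_inner"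
  assumes "finite P" "finite Q" "\<And>p q. g p q 0 = g p q 1" "\<And>p q. g p q (n + 1) = g p q n"
  shows "(\<Sum>p\<in>P. \<Sum>q\<in>Q. \<Sum>i=1..n. g p q i \<bullet> (g p q (i + 1) - 2 *\<^sub>R g p q i + g p q (i - 1))) \<le> 0"
    and "(\<Sum>p\<in>P. \<Sum>q\<in>Q. \<Sum>i=1..n. g p q i \<bullet> (g p q (i + 1) - 2 *\<^sub>R g p q i + g p q (i - 1))) = 0
      \<Longrightarrow> p \<in> P \<Longrightarrow> q \<in> Q \<Longrightarrow> i \<in> {1..n} \<Longrightarrow> g p q (i + 1) - 2 *\<^sub>R g p q i + g p q (i - 1) = 0"
proof -
  define S where "S p q = (\<Sum>i=1..n. g p q i \<bullet> (g p q (i + 1) - 2 *\<^sub>R g p q i + g p q (i - 1)))" for p q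
  have S: "S p q \<le> 0" for p q
    unfolding S_def by (rule neumann_second_difference(1)[of "g p q", OF assms(3,4)])
  then show "(\<Sum>p\<in>P. \<Sum>q\<in>Q. \<Sum>i=1..n. g p q i \<bullet> (g p q (i + 1) - 2 *\<^sub>R g p q i + g p q (i - 1))) \<le> 0"
    unfolding S_def[symmetric] by (intro sum_nonpos)
  assume "(\<Sum>p\<in>P. \<Sum>q\<in>Q. \<Sum>i=1..n. g p q i \<bullet> (g p q (i + 1) - 2 *\<^sub>R g p q i + g p q (i - 1))) = 0"
    and pq: "p \<in> P" "q \<in> Q" and i: "i \<in> {1..n}"
  then have "(\<Sum>p\<in>P. \<Sum>q\<in>Q. - S p q) = 0"
    unfolding S_def[symmetric] by (simp add: sum_negf)
  then have "S p q = 0"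
    using S assms(1,2) pq by (simp add: sum_nonneg_eq_0_iff sum_nonneg)
  then show "g p q (i + 1) - 2 *\<^sub>R g p q i + g p q (i - 1) = 0"
    unfolding S_def using neumann_second_difference(2)[of "g p q", OF assms(3,4) _ i] by blast
qed

text \<open>The quadratic form of the Laplacian splits into three sums, one per direction, each
  nonpositive by the one-dimensional result. If the total is zero, all three are, and then every
  directional second difference vanishes on the grid.\<close>

proposition laplacian_nonpositive:
  assumes n: "nx \<ge> 1" "ny \<ge> 1" "nz \<ge> 1" and h: "h > 0"
  shows "(\<Sum>(j, k, l)\<in>{1..nx} \<times> {1..ny} \<times> {1..nz}. v j k l \<bullet> laplacian nx ny nz h v j k l) \<le> 0"
    and "(\<Sum>(j, k, l)\<in>{1..nx} \<times> {1..ny} \<times> {1..nz}. v j k l \<bullet> laplacian nx ny nz h v j k l) = 0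
      \<Longrightarrow> laplacian nx ny nz h v = 0"
proof -
  define G where "G = {1..nx} \<times> {1..ny} \<times> {1..nz}"
  define w where "w = neumann_ext nx ny nz v"
  define X where "X = (\<lambda>j k l. w (j+1) k l - 2 *\<^sub>R w j k l + w (j-1) k l)"
  define Y where "Y = (\<lambda>j k l. w j (k+1) l - 2 *\<^sub>R w j k l + w j (k-1) l)"
  define Z where "Z = (\<lambda>j k l. w j k (l+1) - 2 *\<^sub>R w j k l + w j k (l-1))"
  \<comment> \<open>In each of the three sums the differenced index is summed innermost, which is
    the shape of the family lemma; \<open>sum.swap\<close> later restores the common order.\<close>
  define sX where "sX = (\<Sum>k=1..ny. \<Sum>l=1..nz. \<Sum>j=1..nx. w j k l \<bullet> X j k l)"
  define sY where "sY = (\<Sum>j=1..nx. \<Sum>l=1..nz. \<Sum>k=1..ny. w j k l \<bullet> Y j k l)"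
  define sZ where "sZ = (\<Sum>j=1..nx. \<Sum>k=1..ny. \<Sum>l=1..nz. w j k l \<bullet> Z j k l)"
  note fam = neumann_second_difference_family
  have ghost: "ghost n 0 = ghost n 1" "ghost n (n + 1) = ghost n n" if "n \<ge> 1" for n
    using that by (auto simp: ghost_def)
  \<comment> \<open>These hold for arbitrary values of the other two indices, since
    \<open>neumann_ext\<close> adjusts each index separately.\<close>
  have bdX: "w 0 k l = w 1 k l" "w (nx + 1) k l = w nx k l"
    and bdY: "w j 0 l = w j 1 l" "w j (ny + 1) l = w j ny l"
    and bdZ: "w j k 0 = w j k 1" "w j k (nz + 1) = w j k nz" for j k l
    unfolding w_def neumann_ext_def using ghost n by simp_all
  have sX: "sX \<le> 0"
    unfolding sX_def X_def
    using fam(1)[of "{1..ny}" "{1..nz}" "\<lambda>k l j. w j k l" nx, OF _ _ bdX] by blast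
  have X0: "X j k l = 0" if "sX = 0" "(j, k, l) \<in> G" for j k l
    using that unfolding sX_def X_def G_def
    using fam(2)[of "{1..ny}" "{1..nz}" "\<lambda>k l j. w j k l" nx k l j, OF _ _ bdX] by blast
  have sY: "sY \<le> 0"
    unfolding sY_def Y_def
    using fam(1)[of "{1..nx}" "{1..nz}" "\<lambda>j l k. w j k l" ny, OF _ _ bdY] by blast
  have Y0: "Y j k l = 0" if "sY = 0" "(j, k, l) \<in> G" for j k l
    using that unfolding sY_def Y_def G_def
    using fam(2)[of "{1..nx}" "{1..nz}" "\<lambda>j l k. w j k l" ny j l k, OF _ _ bdY] by blast
  have sZ: "sZ \<le> 0"
    unfolding sZ_def Z_def
    using fam(1)[of "{1..nx}" "{1..ny}" "\<lambda>j k l. w j k l" nz, OF _ _ bdZ] by blast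
  have Z0: "Z j k l = 0" if "sZ = 0" "(j, k, l) \<in> G" for j k l
    using that unfolding sZ_def Z_def G_def
    using fam(2)[of "{1..nx}" "{1..ny}" "\<lambda>j k l. w j k l" nz j k l, OF _ _ bdZ] by blast
  have triple: "(\<Sum>(j, k, l)\<in>G. f j k l) = (\<Sum>j=1..nx. \<Sum>k=1..ny. \<Sum>l=1..nz. f j k l)"
    for f :: "nat \<Rightarrow> nat \<Rightarrow> nat \<Rightarrow> real"
    unfolding G_def by (simp add: sum.cartesian_product)
  have X: "(\<Sum>(j, k, l)\<in>G. w j k l \<bullet> X j k l) = sX"
    unfolding triple sX_def
    by (subst sum.swap) (intro sum.cong refl sum.swap)
  have Y: "(\<Sum>(j, k, l)\<in>G. w j k l \<bullet> Y j k l) = sY"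
    unfolding triple sY_def
    by (intro sum.cong refl sum.swap)
  have Z: "(\<Sum>(j, k, l)\<in>G. w j k l \<bullet> Z j k l) = sZ"
    unfolding triple sZ_def ..
  have lap: "laplacian nx ny nz h v j k l
      = (if (j, k, l) \<in> G then (X j k l + Y j k l + Z j k l) /\<^sub>R h\<^sup>2 else 0)" for j k l
    unfolding laplacian_def Let_def G_def X_def Y_def Z_def w_def scaleR_right_distrib ..
  have wv: "w j k l = v j k l" if "(j, k, l) \<in> G" for j k l
    using that by (auto simp: w_def neumann_ext_def ghost_def G_def)
  have "v j k l \<bullet> laplacian nx ny nz h v j k l
      = (w j k l \<bullet> X j k l + w j k l \<bullet> Y j k l + w j k l \<bullet> Z j k l) / h\<^sup>2"
    if "(j, k, l) \<in> G" for j k l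
    unfolding lap wv[OF that] using that by (simp add: inner_add_right divide_inverse_commute)
  then have "(\<Sum>(j, k, l)\<in>G. v j k l \<bullet> laplacian nx ny nz h v j k l)
      = (\<Sum>(j, k, l)\<in>G. (w j k l \<bullet> X j k l + w j k l \<bullet> Y j k l + w j k l \<bullet> Z j k l) / h\<^sup>2)"
    by (intro sum.cong) auto
  also have "\<dots> = (sX + sY + sZ) / h\<^sup>2"
    unfolding X[symmetric] Y[symmetric] Z[symmetric]
    by (simp add: case_prod_beta sum.distrib sum_divide_distrib add_divide_distrib)
  finally have eq: "(\<Sum>(j, k, l)\<in>G. v j k l \<bullet> laplacian nx ny nz h v j k l) = (sX + sY + sZ) / h\<^sup>2" .
  show "(\<Sum>(j, k, l)\<in>{1..nx} \<times> {1..ny} \<times> {1..nz}. v j k l \<bullet> laplacian nx ny nz h v j k l) \<le> 0"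
    unfolding G_def[symmetric] eq using sX sY sZ by (intro divide_nonpos_nonneg) auto
  assume "(\<Sum>(j, k, l)\<in>{1..nx} \<times> {1..ny} \<times> {1..nz}. v j k l \<bullet> laplacian nx ny nz h v j k l) = 0"
  then have "sX = 0 \<and> sY = 0 \<and> sZ = 0"
    unfolding G_def[symmetric] eq using h sX sY sZ by auto
  with X0 Y0 Z0 show "laplacian nx ny nz h v = 0"
    by (intro ext) (simp add: lap)
qed

section \<open>Linearity and injectivity of \<open>I + A S\<close>\<close>

lemma grid_linear_laplacian: "grid_linear (laplacian nx ny nz h)"
proof -
  have scale: "c *\<^sub>R x - 2 *\<^sub>R (c *\<^sub>R y) + c *\<^sub>R z = c *\<^sub>R (x - 2 *\<^sub>R y + z)"
    for c :: real and x y z :: "real^3"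
    by (simp add: scaleR_right_distrib scaleR_right_diff_distrib)
  have "laplacian nx ny nz h (u + v) = laplacian nx ny nz h u + laplacian nx ny nz h v" for u v
    unfolding laplacian_def neumann_ext_def Let_def
    by (simp add: fun_eq_iff scaleR_right_distrib scaleR_right_diff_distrib)
  moreover have "laplacian nx ny nz h (c *\<^sub>g v) = c *\<^sub>g laplacian nx ny nz h v" for c v
    unfolding laplacian_def neumann_ext_def gscale_def Let_def scale scaleR_left_commute[of "inverse (h\<^sup>2)" c]
    by (simp add: fun_eq_iff scaleR_right_distrib[symmetric])
  ultimately show ?thesis by (simp add: grid_linear_def)
qed

lemma gscale_add: "c *\<^sub>g (u + v) = c *\<^sub>g u + c *\<^sub>g v"
  and gscale_diff: "c *\<^sub>g (u - v) = c *\<^sub>g u - c *\<^sub>g v"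
  and gscale_left_commute: "b *\<^sub>g c *\<^sub>g v = c *\<^sub>g b *\<^sub>g v"
  by (simp_all add: gscale_def fun_eq_iff scaleR_right_distrib scaleR_right_diff_distrib)

lemma gcross_add_right: "m \<times>\<^sub>g (u + v) = m \<times>\<^sub>g u + m \<times>\<^sub>g v"
  and gcross_diff_right: "m \<times>\<^sub>g (u - v) = m \<times>\<^sub>g u - m \<times>\<^sub>g v"
  and gcross_gscale_right: "m \<times>\<^sub>g (c *\<^sub>g v) = c *\<^sub>g (m \<times>\<^sub>g v)"
  by (simp_all add: gcross_def gscale_def fun_eq_iff cross_add_right Cross3.right_diff_distrib
      cross_mult_right)

lemma grid_linear_opA_opS:
  "grid_linear (\<lambda>v. v + opA m (opS nx ny nz h dt \<epsilon> \<alpha> \<eta> v))"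
proof -
  have add: "laplacian nx ny nz h (u + v) = laplacian nx ny nz h u + laplacian nx ny nz h v"
    and scale: "laplacian nx ny nz h (c *\<^sub>g v) = c *\<^sub>g laplacian nx ny nz h v" for u v c
    using grid_linear_laplacian unfolding grid_linear_def by blast+
  have "opS nx ny nz h dt \<epsilon> \<alpha> \<eta> (u + v) = opS nx ny nz h dt \<epsilon> \<alpha> \<eta> u + opS nx ny nz h dt \<epsilon> \<alpha> \<eta> v" for u v
    unfolding opS_def add gscale_add by (rule add_diff_add)
  moreover have "opS nx ny nz h dt \<epsilon> \<alpha> \<eta> (c *\<^sub>g v) = c *\<^sub>g opS nx ny nz h dt \<epsilon> \<alpha> \<eta> v" for c v
    unfolding opS_def scale gscale_diff gscale_left_commute[of c] ..
  ultimately show ?thesis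
    unfolding grid_linear_def opA_def
    by (simp only: gcross_add_right gcross_gscale_right gscale_add add_ac) simp
qed

text \<open>Only signs matter: both parts of \<open>S\<close> are nonpositive, so no relation
  between \<open>h\<close> and \<open>dt\<close> enters.\<close>

lemma opA_opS_injective:
  assumes "nx \<ge> 1" "ny \<ge> 1" "nz \<ge> 1" "\<epsilon> > 0" "\<alpha> \<ge> 0" "\<eta> \<ge> 0" "h > 0" "dt > 0"
    and eq: "v + opA m (opS nx ny nz h dt \<epsilon> \<alpha> \<eta> v) = 0"
  shows "v = 0"
proof -
  define G where "G = {1..nx} \<times> {1..ny} \<times> {1..nz}"
  define c where "c = \<alpha> * (1 + 2 * \<eta> / dt)"
  define L where "L = laplacian nx ny nz h v"
  define E where "E = (\<Sum>(j, k, l)\<in>G. v j k l \<bullet> L j k l)"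
  define Q where "Q = (\<Sum>(j, k, l)\<in>G. v j k l \<bullet> v j k l)"
  \<comment> \<open>The kernel equation solved for \<open>v\<close> at one grid point; the second
    factor of the cross product is \<open>S v\<close>.\<close>
  have pt: "v j k l = - cross3 (m j k l) ((\<epsilon> * dt) *\<^sub>R L j k l - c *\<^sub>R v j k l)" for j k l
    using fun_cong[OF fun_cong[OF fun_cong[OF eq]], of j k l]
    by (simp add: opA_def opS_def gcross_def gscale_def c_def L_def eq_neg_iff_add_eq_0)
  have orth: "v j k l \<bullet> ((\<epsilon> * dt) *\<^sub>R L j k l - c *\<^sub>R v j k l) = 0" for j k l
    by (subst (1) pt) (simp add: dot_cross_self)
  have "c \<ge> 0" using assms(5,6,8) by (simp add: c_def)
  have "0 = (\<Sum>(j, k, l)\<in>G. v j k l \<bullet> ((\<epsilon> * dt) *\<^sub>R L j k l - c *\<^sub>R v j k l))"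
    by (simp only: orth) simp
  also have "\<dots> = \<epsilon> * dt * E - c * Q"
    by (simp add: E_def Q_def inner_diff_right case_prod_beta sum_subtractf sum_distrib_left)
  finally have bal: "\<epsilon> * dt * E = c * Q" by simp
  have "Q \<ge> 0" unfolding Q_def by (intro sum_nonneg) auto
  have E: "E \<le> 0"
    using laplacian_nonpositive(1)[OF assms(1-3,7)] by (simp add: E_def G_def L_def)
  \<comment> \<open>The balance equates a nonpositive quantity with a nonnegative one, so both are
    zero.\<close>
  have "\<epsilon> * dt * E \<ge> 0" using bal \<open>c \<ge> 0\<close> \<open>Q \<ge> 0\<close> by simp
  then have "E = 0" using E assms(4,8) by (auto simp: zero_le_mult_iff mult_le_0_iff)
  then have "L = 0"
    using laplacian_nonpositive(2)[OF assms(1-3,7)] by (simp add: E_def G_def L_def)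
  \<comment> \<open>With \<open>L = 0\<close> the equation reads \<open>v = c m \<times> v\<close>,
    and pairing with \<open>v\<close> gives \<open>v \<bullet> v = 0\<close>. This also covers
    \<open>c = 0\<close>, where the balance says nothing about \<open>Q\<close>.\<close>
  have "v j k l = 0" for j k l
    using arg_cong[OF pt[of j k l], of "\<lambda>x. v j k l \<bullet> x"]
    by (simp add: \<open>L = 0\<close> cross_mult_right dot_cross_self)
  then show ?thesis by (simp add: fun_eq_iff)
qed

theorem proposition2:
  fixes nx ny nz :: nat and \<epsilon> \<alpha> \<eta> h dt q :: real
    and m_prev m he :: gridfun and hs :: "gridfun \<Rightarrow> gridfun"
  assumes "nx \<ge> 1" "ny \<ge> 1" "nz \<ge> 1"
    and "\<epsilon> > 0" "\<alpha> \<ge> 0" "\<eta> \<ge> 0" "h > 0" "dt > 0"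
    and "m_prev \<in> V nx ny nz" "m \<in> V nx ny nz"
    and "he \<in> V nx ny nz" "\<And>u. u \<in> V nx ny nz \<Longrightarrow> hs u \<in> V nx ny nz"
  shows "op_det nx ny nz (\<lambda>v. v + opA m (opS nx ny nz h dt \<epsilon> \<alpha> \<eta> v)) \<noteq> 0 \<and>
    (\<exists>!u. u \<in> V nx ny nz \<and>
       u + (\<epsilon> * dt) *\<^sub>g (m \<times>\<^sub>g laplacian nx ny nz h u)
         - (\<alpha> * (1 + 2 * \<eta> / dt)) *\<^sub>g (m \<times>\<^sub>g u)
       = m_prev - (\<epsilon> * dt) *\<^sub>g (m \<times>\<^sub>g laplacian nx ny nz h m_prev)
         - (\<alpha> * (1 - 2 * \<eta> / dt)) *\<^sub>g (m \<times>\<^sub>g m_prev)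
         - (2 * dt) *\<^sub>g (m \<times>\<^sub>g explicit_field q he hs m))"
proof -
  let ?T = "\<lambda>v. v + opA m (opS nx ny nz h dt \<epsilon> \<alpha> \<eta> v)"
  define b where "b = m_prev - (\<epsilon> * dt) *\<^sub>g (m \<times>\<^sub>g laplacian nx ny nz h m_prev)
         - (\<alpha> * (1 - 2 * \<eta> / dt)) *\<^sub>g (m \<times>\<^sub>g m_prev)
         - (2 * dt) *\<^sub>g (m \<times>\<^sub>g explicit_field q he hs m)"
  have b: "b \<in> V nx ny nz"
    unfolding b_def using assms(9,10) by (intro V_diff V_gscale V_gcross)
  \<comment> \<open>Distributing the cross product over \<open>S\<close> identifies the left side of
    the scheme with \<open>I + A S\<close>.\<close>
  have T: "u + (\<epsilon> * dt) *\<^sub>g (m \<times>\<^sub>g laplacian nx ny nz h u)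
         - (\<alpha> * (1 + 2 * \<eta> / dt)) *\<^sub>g (m \<times>\<^sub>g u) = ?T u" for u
    by (simp add: opA_def opS_def gcross_diff_right gcross_gscale_right)
  have V: "?T v \<in> V nx ny nz" if "v \<in> V nx ny nz" for v
    using that assms(10) unfolding opA_def by (intro V_add V_gcross)
  have inj: "v = 0" if "?T v = 0" for v
    using opA_opS_injective[OF assms(1-8) that] .
  show ?thesis
    unfolding T b_def[symmetric]
    by (intro conjI injective_operator_on_V[where T = ?T, OF assms(1,2) grid_linear_opA_opS V inj] b)
qed

end
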